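(* Let $M$ be a real $n\times n$ Z-matrix. Then $M$ is a quasi $M$-matrix if and only if $M+\epsilon I$ is a quasi non-singular $M$-matrix for every $\epsilon>0$.
   Context: A real square matrix $M=(m_{ij})$ is a Z-matrix if $m_{ij}\le 0$ for all $i\neq j$. A real Z-matrix is a quasi $M$-matrix if all its proper principal minors (principal minors indexed by proper subsets of the index set) are non-negative, and a quasi non-singular $M$-matrix if all its proper principal minors are positive. $I$ is the $n\times n$ identity matrix. *)

theory Defs
  imports
    Complex_Main
    "Jordan_Normal_Form.Determinant"
    "Jordan_Normal_Form.DL_Submatrix"
begin

definition Z_matrix :: "real mat \<Rightarrow> bool" where
  "Z_matrix M \<longleftrightarrow> square_mat M \<and>
    (\<forall>i < dim_row M. \<forall>j < dim_row M. i \<noteq> j \<longrightarrow> M $$ (i, j) \<le> 0)"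

definition principal_minor :: "real mat \<Rightarrow> nat set \<Rightarrow> real" where
  "principal_minor M S = det (submatrix M S S)"

(* Rows and columns are indexed from 0, so the index set of M is {..<dim_row M}.
   The empty set may occur as S; its minor is the determinant of the 0 x 0 matrix, 1. *)

definition quasi_M_matrix :: "real mat \<Rightarrow> bool" where
  "quasi_M_matrix M \<longleftrightarrow> Z_matrix M \<and>
    (\<forall>S. S \<subset> {..<dim_row M} \<longrightarrow> principal_minor M S \<ge> 0)"

definition quasi_nonsingular_M_matrix :: "real mat \<Rightarrow> bool" where
  "quasi_nonsingular_M_matrix M \<longleftrightarrow> Z_matrix M \<and>
    (\<forall>S. S \<subset> {..<dim_row M} \<longrightarrow> principal_minor M S > 0)"

end

(* Adding x to the k-th diagonal entry of A changes the principal minor on S, for k in S, by x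
   times the principal minor on S - {k}, by Laplace expansion along row k. Raising the diagonal
   entries one at a time, all principal minors of a matrix where they are non-negative stay
   non-negative, and the minor on S becomes positive once all entries in S have been raised: the
   expansion ends at x^|S| times the empty minor 1. The converse is continuity of the determinant. *)
theory Submission
  imports Defs
begin

section \<open>Determinants and a change of one diagonal entry\<close>

text \<open>The cofactors along row \<open>k\<close> do not see row \<open>k\<close>, so they agree
  for \<open>A\<close> and \<open>B\<close>. The two Laplace expansions differ only by
  \<open>x\<close> times the cofactor at \<open>(k, k)\<close>, whose sign is +1.\<close>

lemma det_add_diagonal_entry:
  fixes A B :: "'a :: comm_ring_1 mat"
  assumes A: "A \<in> carrier_mat m m" and B: "B \<in> carrier_mat m m" and k: "k < m"
    and diag: "B $$ (k, k) = A $$ (k, k) + x"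
    and eq: "\<And>i j. i < m \<Longrightarrow> j < m \<Longrightarrow> (i, j) \<noteq> (k, k) \<Longrightarrow> B $$ (i, j) = A $$ (i, j)"
  shows "det B = det A + x * det (mat_delete A k k)"
proof -
  have "mat_delete B k j = mat_delete A k j" if "j < m" for j
    using A B k that by (intro eq_matI) (auto simp: mat_delete_def intro!: eq)
  then have cof: "cofactor B k j = cofactor A k j" if "j < m" for j
    using that by (simp add: cofactor_def)
  have "det B = (\<Sum>j<m. B $$ (k, j) * cofactor A k j)"
    using laplace_expansion_row[OF B k] cof by simp
  also have "\<dots> = (\<Sum>j<m. A $$ (k, j) * cofactor A k j + (if j = k then x * cofactor A k k else 0))"
    using k by (intro sum.cong) (auto simp: diag eq algebra_simps)
  also have "\<dots> = det A + x * cofactor A k k"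
    using k by (simp add: sum.distrib laplace_expansion_row[OF A k])
  finally show ?thesis
    by (simp add: cofactor_def)
qed

section \<open>Removing one index from a principal submatrix\<close>

text \<open>An element of a set is determined by its rank, the number of smaller elements. Dropping
  \<open>k\<close> lowers by one exactly the ranks above that of \<open>k\<close>, and
  \<open>insert_index\<close> undoes this shift.\<close>

lemma pick_remove:
  assumes fin: "finite I" and k: "k \<in> I" and i: "i < card I - 1"
  shows "pick (I - {k}) i = pick I (insert_index (card {a \<in> I. a < k}) i)"
proof -
  define p where "p = card {a \<in> I. a < k}"
  define q where "q = insert_index p i"
  have q: "q < card I"
    using i by (auto simp: q_def insert_index_def)
  define b where "b = pick I q"
  have b: "b \<in> I" and cb: "card {a \<in> I. a < b} = q"
    using pick_in_set_le[OF q] card_pick_le[OF q] by (auto simp: b_def)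
  \<comment> \<open>The rank of \<open>k\<close> in \<open>I\<close> is \<open>p\<close>, a value
    that \<open>insert_index p\<close> skips.\<close>
  have "b \<noteq> k"
    using cb insert_index_exclude[of p i] unfolding q_def p_def by metis
  have "card {a \<in> I - {k}. a < b} = i"
  proof (cases "b < k")
    case True
    then have "{a \<in> I - {k}. a < b} = {a \<in> I. a < b}"
      by auto
    moreover have "card {a \<in> I. a < b} < p"
      unfolding p_def using True b fin by (intro psubset_card_mono) auto
    ultimately show ?thesis
      using cb by (auto simp: q_def insert_index_def split: if_splits)
  next
    case False
    with \<open>b \<noteq> k\<close> have "k < b" by simp
    then have "{a \<in> I - {k}. a < b} = {a \<in> I. a < b} - {k}"
      by auto
    with k \<open>k < b\<close> fin have "card {a \<in> I - {k}. a < b} = q - 1"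
      by (simp add: cb)
    moreover have "p < q"
      unfolding cb[symmetric] p_def using \<open>k < b\<close> k fin by (intro psubset_card_mono) auto
    ultimately show ?thesis
      by (auto simp: q_def insert_index_def split: if_splits)
  qed
  then have "pick (I - {k}) i = b"
    using pick_card_in_set[of b "I - {k}"] b \<open>b \<noteq> k\<close> by simp
  then show ?thesis
    by (simp add: b_def q_def p_def)
qed

lemma submatrix_index_subset:
  assumes "A \<in> carrier_mat n n" and "S \<subseteq> {..<n}" and "i < card S" and "j < card S"
  shows "submatrix A S S $$ (i, j) = A $$ (pick S i, pick S j)"
proof -
  have "{a. a < n \<and> a \<in> S} = S" using assms by auto
  then show ?thesis using assms by (intro submatrix_index) auto
qed

lemma submatrix_carrier_subset:
  assumes "A \<in> carrier_mat n n" and "S \<subseteq> {..<n}"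
  shows "submatrix A S S \<in> carrier_mat (card S) (card S)"
proof -
  have "{a. a < n \<and> a \<in> S} = S" using assms by auto
  then show ?thesis using assms by (intro carrier_matI) (auto simp: dim_submatrix)
qed

text \<open>The index \<open>k\<close> occupies position \<open>p\<close> in \<open>S\<close>, so
  deleting that row and column amounts to dropping \<open>k\<close> from the index set. This turns
  the minor in the Laplace expansion into a principal minor of \<open>A\<close>.\<close>

lemma mat_delete_submatrix:
  assumes A: "A \<in> carrier_mat n n" and S: "S \<subseteq> {..<n}" and k: "k \<in> S"
  defines "p \<equiv> card {a \<in> S. a < k}"
  shows "mat_delete (submatrix A S S) p p = submatrix A (S - {k}) (S - {k})"
proof -
  have fin: "finite S" using S finite_subset by blast
  have cS: "card (S - {k}) = card S - 1" using k fin by simp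
  have S': "S - {k} \<subseteq> {..<n}" using S by auto
  note car = submatrix_carrier_subset[OF A S]
  note car' = submatrix_carrier_subset[OF A S', unfolded cS]
  show ?thesis
  proof (rule eq_matI)
    fix i j
    assume "i < dim_row (submatrix A (S - {k}) (S - {k}))"
      and "j < dim_col (submatrix A (S - {k}) (S - {k}))"
    then have ij: "i < card S - 1" "j < card S - 1"
      using car' by auto
    then have "mat_delete (submatrix A S S) p p $$ (i, j)
        = submatrix A S S $$ (insert_index p i, insert_index p j)"
      using car by (simp add: mat_delete_def insert_index_def)
    also have "\<dots> = A $$ (pick S (insert_index p i), pick S (insert_index p j))"
      using ij by (intro submatrix_index_subset[OF A S]) (auto simp: insert_index_def)
    also have "\<dots> = A $$ (pick (S - {k}) i, pick (S - {k}) j)"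
      using ij by (simp add: p_def pick_remove[OF fin k])
    also have "\<dots> = submatrix A (S - {k}) (S - {k}) $$ (i, j)"
      using ij cS by (intro submatrix_index_subset[OF A S', symmetric]) auto
    finally show "mat_delete (submatrix A S S) p p $$ (i, j)
        = submatrix A (S - {k}) (S - {k}) $$ (i, j)" .
  qed (use car car' in auto)
qed

section \<open>Principal minors under diagonal shifts\<close>

text \<open>The set \<open>T\<close> records which diagonal entries have been raised so far, so that
  the passage from \<open>A\<close> to \<open>A\<close> plus \<open>x\<close> times the identity can
  be made by induction.\<close>

definition diag_shift :: "'a :: comm_ring_1 mat \<Rightarrow> 'a \<Rightarrow> nat set \<Rightarrow> 'a mat" where
  "diag_shift A x T = mat (dim_row A) (dim_col A)
    (\<lambda>(i, j). A $$ (i, j) + (if i = j \<and> i \<in> T then x else 0))"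

lemma diag_shift_carrier: "A \<in> carrier_mat n n \<Longrightarrow> diag_shift A x T \<in> carrier_mat n n"
  by (auto simp: diag_shift_def)

lemma diag_shift_index:
  "A \<in> carrier_mat n n \<Longrightarrow> i < n \<Longrightarrow> j < n \<Longrightarrow>
    diag_shift A x T $$ (i, j) = A $$ (i, j) + (if i = j \<and> i \<in> T then x else 0)"
  by (auto simp: diag_shift_def)

lemma diag_shift_empty: "diag_shift A x {} = A"
  by (auto simp: diag_shift_def)

lemma principal_minor_diag_shift_insert:
  assumes A: "A \<in> carrier_mat n n" and S: "S \<subseteq> {..<n}" and k: "k \<in> S" "k \<notin> T"
  shows "principal_minor (diag_shift A x (insert k T)) S
    = principal_minor (diag_shift A x T) S + x * principal_minor (diag_shift A x T) (S - {k})"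
proof -
  define p where "p = card {a \<in> S. a < k}"
  have fin: "finite S" using S finite_subset by blast
  have p: "p < card S"
    unfolding p_def using k fin by (intro psubset_card_mono) auto
  have pick_p: "pick S p = k"
    using k by (simp add: p_def pick_card_in_set)
  have pick_n: "pick S i < n" if "i < card S" for i
    using pick_in_set_le[OF that] S by auto
  \<comment> \<open>A position is recovered from its element as a rank, so the changed entry appears
    in the submatrix at \<open>(p, p)\<close> and nowhere else.\<close>
  have pick_k: "pick S i = k \<longleftrightarrow> i = p" if "i < card S" for i
    using card_pick_le[OF that] pick_p by (auto simp: p_def)
  let ?B = "diag_shift A x T" and ?C = "diag_shift A x (insert k T)"
  note B = diag_shift_carrier[OF A, of x T] and C = diag_shift_carrier[OF A, of x "insert k T"]
  have "det (submatrix ?C S S) = det (submatrix ?B S S) + x * det (mat_delete (submatrix ?B S S) p p)"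
  proof (rule det_add_diagonal_entry[OF submatrix_carrier_subset[OF B S] submatrix_carrier_subset[OF C S] p])
    show "submatrix ?C S S $$ (p, p) = submatrix ?B S S $$ (p, p) + x"
      using p k S by (auto simp: submatrix_index_subset[OF B S] submatrix_index_subset[OF C S]
          pick_p diag_shift_index[OF A])
  next
    fix i j
    assume ij: "i < card S" "j < card S" "(i, j) \<noteq> (p, p)"
    then have "\<not> (pick S i = k \<and> pick S j = k)"
      using pick_k by blast
    then show "submatrix ?C S S $$ (i, j) = submatrix ?B S S $$ (i, j)"
      using ij pick_n by (auto simp: submatrix_index_subset[OF B S] submatrix_index_subset[OF C S]
          diag_shift_index[OF A])
  qed
  then show ?thesis
    using mat_delete_submatrix[OF B S k(1)] by (simp add: principal_minor_def p_def)
qed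

text \<open>Induction on \<open>T\<close> with \<open>S\<close> arbitrary: the expansion at a new
  \<open>k\<close> involves the minors on both \<open>S\<close> and \<open>S - {k}\<close>, with
  \<open>T\<close> contained in each.\<close>

lemma principal_minor_diag_shift_nonneg:
  assumes A: "A \<in> carrier_mat n n" and x: "x \<ge> 0" and S: "S \<subseteq> {..<n}" and T: "T \<subseteq> S"
    and minors: "\<And>R. R \<subseteq> S \<Longrightarrow> principal_minor A R \<ge> 0"
  shows "principal_minor (diag_shift A x T) S \<ge> 0"
proof -
  have "finite T" using T S by (meson finite_lessThan finite_subset)
  then show ?thesis
    using S T minors
  proof (induction T arbitrary: S rule: finite_induct)
    case empty
    then show ?case by (simp add: diag_shift_empty)
  next
    case (insert k T)
    have TS: "k \<in> S" "T \<subseteq> S" "S - {k} \<subseteq> {..<n}" "T \<subseteq> S - {k}"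
      using insert.prems(1,2) insert.hyps(2) by auto
    have sub: "principal_minor A R \<ge> 0" if "R \<subseteq> S - {k}" for R
      using that by (intro insert.prems(3)) blast
    have "principal_minor (diag_shift A x T) S \<ge> 0"
      by (rule insert.IH[OF insert.prems(1) TS(2) insert.prems(3)])
    moreover have "principal_minor (diag_shift A x T) (S - {k}) \<ge> 0"
      by (rule insert.IH[OF TS(3,4) sub])
    ultimately show ?case
      unfolding principal_minor_diag_shift_insert[OF A insert.prems(1) TS(1) insert.hyps(2)]
      using x by simp
  qed
qed

text \<open>Induction on \<open>S\<close>, raising the newest entry \<open>k\<close> last. The
  expansion is then a non-negative minor plus \<open>x\<close> times a positive one; the base case
  is the determinant 1 of the empty matrix.\<close>

lemma principal_minor_diag_shift_pos:
  assumes A: "A \<in> carrier_mat n n" and x: "x > 0" and S: "S \<subseteq> {..<n}"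
    and minors: "\<And>R. R \<subseteq> S \<Longrightarrow> principal_minor A R \<ge> 0"
  shows "principal_minor (diag_shift A x S) S > 0"
proof -
  have "finite S" using S finite_subset by blast
  then show ?thesis
    using S minors
  proof (induction S rule: finite_induct)
    case empty
    then show ?case
      using submatrix_carrier_subset[OF A, of "{}"]
      by (simp add: diag_shift_empty principal_minor_def)
  next
    case (insert k S)
    have "principal_minor (diag_shift A x S) S > 0"
      using insert.prems(1) by (intro insert.IH insert.prems(2)) auto
    \<comment> \<open>Entry \<open>k\<close> is not yet raised here, so this minor may vanish;
      strict positivity comes from the other summand.\<close>
    moreover have "principal_minor (diag_shift A x S) (insert k S) \<ge> 0"
      using insert.prems x by (intro principal_minor_diag_shift_nonneg[OF A]) auto
    moreover have "principal_minor (diag_shift A x (insert k S)) (insert k S)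
        = principal_minor (diag_shift A x S) (insert k S) + x * principal_minor (diag_shift A x S) S"
      using principal_minor_diag_shift_insert[OF A insert.prems(1), of k S x] insert.hyps by simp
    ultimately show ?case
      using x by (simp add: add_nonneg_pos)
  qed
qed

text \<open>The minor on \<open>S\<close> does not see diagonal entries outside \<open>S\<close>, so
  raising all of them has the same effect as raising those in \<open>S\<close>.\<close>

lemma principal_minor_add_smult_one:
  assumes A: "A \<in> carrier_mat n n" and S: "S \<subseteq> {..<n}"
  shows "principal_minor (A + x \<cdot>\<^sub>m 1\<^sub>m n) S = principal_minor (diag_shift A x S) S"
proof -
  have C: "A + x \<cdot>\<^sub>m 1\<^sub>m n \<in> carrier_mat n n" using A by simp
  note B = diag_shift_carrier[OF A, of x S]
  note car = submatrix_carrier_subset[OF C S] submatrix_carrier_subset[OF B S]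
  have pick_S: "pick S i < n" "pick S i \<in> S" if "i < card S" for i
    using pick_in_set_le[OF that] S by auto
  have "submatrix (A + x \<cdot>\<^sub>m 1\<^sub>m n) S S = submatrix (diag_shift A x S) S S"
  proof (rule eq_matI)
    fix i j
    assume "i < dim_row (submatrix (diag_shift A x S) S S)"
      and "j < dim_col (submatrix (diag_shift A x S) S S)"
    then have "i < card S" "j < card S" using car by auto
    then show "submatrix (A + x \<cdot>\<^sub>m 1\<^sub>m n) S S $$ (i, j) = submatrix (diag_shift A x S) S S $$ (i, j)"
      using A pick_S by (simp add: submatrix_index_subset[OF B S] submatrix_index_subset[OF C S]
          diag_shift_index[OF A])
  qed (use car in auto)
  then show ?thesis by (simp add: principal_minor_def)
qed

section \<open>Continuity of principal minors\<close>

text \<open>By the Leibniz formula the determinant is a polynomial in the entries, so entrywise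
  limits pass through it.\<close>

lemma tendsto_det:
  fixes f :: "'b \<Rightarrow> real mat"
  assumes f: "\<And>x. f x \<in> carrier_mat m m" and A: "A \<in> carrier_mat m m"
    and lim: "\<And>i j. i < m \<Longrightarrow> j < m \<Longrightarrow> ((\<lambda>x. f x $$ (i, j)) \<longlongrightarrow> A $$ (i, j)) F"
  shows "((\<lambda>x. det (f x)) \<longlongrightarrow> det A) F"
  unfolding det_def'[OF f] det_def'[OF A]
  by (intro tendsto_sum tendsto_mult tendsto_const tendsto_prod lim)
    (auto simp: permutes_in_image)

text \<open>Each entry is affine in \<open>x\<close> with the entry of \<open>A\<close> as its value
  at 0. The limit is taken from the right because the theorem controls the shifted minors for
  positive shifts.\<close>

lemma tendsto_principal_minor_add_smult_one:
  assumes A: "A \<in> carrier_mat n n" and S: "S \<subseteq> {..<n}"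
  shows "((\<lambda>x. principal_minor (A + x \<cdot>\<^sub>m 1\<^sub>m n) S) \<longlongrightarrow> principal_minor A S) (at_right 0)"
  unfolding principal_minor_def
proof (rule tendsto_det)
  have C: "A + x \<cdot>\<^sub>m 1\<^sub>m n \<in> carrier_mat n n" for x using A by simp
  show "submatrix (A + x \<cdot>\<^sub>m 1\<^sub>m n) S S \<in> carrier_mat (card S) (card S)" for x
    by (rule submatrix_carrier_subset[OF C S])
  show "submatrix A S S \<in> carrier_mat (card S) (card S)"
    by (rule submatrix_carrier_subset[OF A S])
  fix i j
  assume ij: "i < card S" "j < card S"
  have "pick S i < n" "pick S j < n"
    using pick_in_set_le[OF ij(1)] pick_in_set_le[OF ij(2)] S by auto
  then have "submatrix (A + x \<cdot>\<^sub>m 1\<^sub>m n) S S $$ (i, j)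
      = submatrix A S S $$ (i, j) + x * (if pick S i = pick S j then 1 else 0)" for x
    using A by (simp add: submatrix_index_subset[OF C S ij] submatrix_index_subset[OF A S ij])
  then show "((\<lambda>x. submatrix (A + x \<cdot>\<^sub>m 1\<^sub>m n) S S $$ (i, j)) \<longlongrightarrow> submatrix A S S $$ (i, j))
      (at_right 0)"
    by (auto intro!: tendsto_eq_intros)
qed

theorem theorem2p12:
  fixes M :: "real mat" and n :: nat
  assumes "M \<in> carrier_mat n n"
    and "Z_matrix M"
  shows "quasi_M_matrix M \<longleftrightarrow>
    (\<forall>\<epsilon>::real. \<epsilon> > 0 \<longrightarrow> quasi_nonsingular_M_matrix (M + \<epsilon> \<cdot>\<^sub>m 1\<^sub>m n))"
proof (intro iffI allI impI)
  fix \<epsilon> :: real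
  assume qM: "quasi_M_matrix M" and "\<epsilon> > 0"
  have "Z_matrix (M + \<epsilon> \<cdot>\<^sub>m 1\<^sub>m n)"
    using assms by (auto simp: Z_matrix_def)
  moreover have "principal_minor (M + \<epsilon> \<cdot>\<^sub>m 1\<^sub>m n) S > 0" if S: "S \<subset> {..<n}" for S
  proof -
    \<comment> \<open>A subset of a proper subset is again proper, so every minor used in the
      induction is covered by the hypothesis on \<open>M\<close>.\<close>
    have "principal_minor M R \<ge> 0" if "R \<subseteq> S" for R
      using qM S that assms(1) by (auto simp: quasi_M_matrix_def)
    then have "principal_minor (diag_shift M \<epsilon> S) S > 0"
      using S \<open>\<epsilon> > 0\<close> by (intro principal_minor_diag_shift_pos[OF assms(1)]) auto
    then show ?thesis
      using S by (subst principal_minor_add_smult_one[OF assms(1)]) auto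
  qed
  ultimately show "quasi_nonsingular_M_matrix (M + \<epsilon> \<cdot>\<^sub>m 1\<^sub>m n)"
    using assms(1) by (simp add: quasi_nonsingular_M_matrix_def)
next
  assume qN: "\<forall>\<epsilon>::real. \<epsilon> > 0 \<longrightarrow> quasi_nonsingular_M_matrix (M + \<epsilon> \<cdot>\<^sub>m 1\<^sub>m n)"
  have "principal_minor M S \<ge> 0" if S: "S \<subset> {..<n}" for S
  \<comment> \<open>The shifted minors are positive, and the weak inequality survives the limit
    since \<open>at_right 0\<close> is a non-trivial filter.\<close>
  proof (rule tendsto_lowerbound)
    show "((\<lambda>x. principal_minor (M + x \<cdot>\<^sub>m 1\<^sub>m n) S) \<longlongrightarrow> principal_minor M S) (at_right 0)"
      using S by (intro tendsto_principal_minor_add_smult_one[OF assms(1)]) auto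
    have "principal_minor (M + x \<cdot>\<^sub>m 1\<^sub>m n) S \<ge> 0" if "x > 0" for x
      using qN that S assms(1) by (auto simp: quasi_nonsingular_M_matrix_def intro: less_imp_le)
    then show "\<forall>\<^sub>F x in at_right 0. 0 \<le> principal_minor (M + x \<cdot>\<^sub>m 1\<^sub>m n) S"
      by (auto simp: eventually_at_filter)
  qed simp
  then show "quasi_M_matrix M"
    using assms by (auto simp: quasi_M_matrix_def)
qed

end
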